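(* Let $n_1,n_2,n_3,n_4\in\mathbb C\setminus\{0\}$ and $\alpha_0,\dots,\alpha_4\in\mathbb C$. Suppose that a system of the form $(S)$ (see context), with coefficients $a_1,\dots,a_{10}\in\mathbb C(t)$, has the Painlevé scheme $$\begin{pmatrix} X=0 & X=1 & X=t & X=\infty\\ f_0\begin{pmatrix}n_1&\alpha_4\\0&1\end{pmatrix} & f_1\begin{pmatrix}n_2&\alpha_3\\0&1\end{pmatrix} & f_2\begin{pmatrix}n_3&\alpha_0\\0&1\end{pmatrix} & f_3\begin{pmatrix}n_4&\alpha_1\\0&1\end{pmatrix}\end{pmatrix}$$ for some $f_0,f_1,f_2,f_3\in\mathbb C(t)$; that is, $X=0,1,t,\infty$ are accessible singular points and the matrix of linear approximation at each of them is the one listed below it. Then $$\frac1{n_1}+\frac1{n_2}+\frac1{n_3}+\frac1{n_4}=2.$$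
   Context: System $(S)$: for a constant $\alpha_2\in\mathbb C$ and $a_i=a_i(t)\in\mathbb C(t)$, $$\frac{dx}{dt}=a_1x^3y+a_2x^2y+a_5xy+a_7y+\tfrac12\big((3a_1+2a_3)\alpha_2-a_4\big)x^2+\big((a_2+a_9)\alpha_2-a_6\big)x+a_8,$$ $$\frac{dy}{dt}=a_3x^2y^2+a_9xy^2+a_{10}y^2+a_4xy+a_6y+\tfrac12(a_1\alpha_2+a_4)\alpha_2 .$$ This system is also polynomial in the coordinates $(x_1,y_1)=(1/x,\,-(xy+\alpha_2)x)$. Local coordinates: at the point $X=c$ with $c\in\{0,1,t\}$ use $(X,Y)=(x-c,1/y)$ (for $c=t$ one has $dX/dt=dx/dt-1$); at $X=\infty$ use $(X,Y)=(x_1,1/y_1)$. In each of these coordinates the system has the form $\frac{dX}{dt}=\frac{G(X,Y)}{Y}$, $\frac{dY}{dt}=H(X,Y)$ with $G,H\in\mathbb C(t)[X,Y]$. The point $(X,Y)=(0,0)$ is an accessible singular point if $G(0,0)=0$. Its matrix of linear approximation is the matrix $M=\begin{pmatrix}M_{11}&M_{12}\\0&M_{22}\end{pmatrix}$ over $\mathbb C(t)$ such that $\frac{d}{dt}\binom{X}{Y}=\frac1Y\left\{M\binom XY+(\text{terms of order}\ge 2\text{ in }X,Y)\right\}$, i.e. $G=M_{11}X+M_{12}Y+O(2)$ and $H(0,0)=M_{22}$. A Painlevé scheme is a list of accessible singular points together with their matrices of linear approximation. *)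

theory Defs
  imports
    "HOL-Analysis.Determinants"
    "HOL-Computational_Algebra.Polynomial_Factorial"
begin

text \<open>
  The field \<open>\<complex>(t)\<close>, the polynomial ring \<open>\<complex>(t)[X,Y]\<close> (as polynomials in \<open>Y\<close> over
  \<open>\<complex>(t)[X]\<close>, so that \<open>coeff (coeff G j) i\<close> is the coefficient of \<open>X\<^sup>i Y\<^sup>j\<close>), and the
  field \<open>\<complex>(t)(x,y)\<close>.
\<close>

type_synonym ratfun = "complex poly fract"
type_synonym bipoly = "ratfun poly poly"
type_synonym biratfun = "bipoly fract"

definition const :: "complex \<Rightarrow> ratfun" where
  "const c = to_fract [:c:]"

definition tvar :: ratfun where
  "tvar = to_fract [:0, 1:]"

definition emb :: "ratfun \<Rightarrow> biratfun" where
  "emb r = to_fract [:[:r:]:]"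

definition xvar :: biratfun where
  "xvar = to_fract [:[:0, 1:]:]"

definition yvar :: biratfun where
  "yvar = to_fract [:0, 1:]"

definition eval2 :: "bipoly \<Rightarrow> biratfun \<Rightarrow> biratfun \<Rightarrow> biratfun" where
  "eval2 G X Y = poly (map_poly (\<lambda>p. poly (map_poly emb p) X) G) Y"

text \<open>
  A derivation of \<open>\<complex>(t)(x,y)\<close> extending \<open>d/dt\<close> on \<open>\<complex>(t)\<close>.  A system
  \<open>dx/dt = F\<close>, \<open>dy/dt = E\<close> with \<open>F, E \<in> \<complex>(t)[x,y]\<close> is the same thing as the unique such
  derivation \<open>D\<close> with \<open>D x = F\<close> and \<open>D y = E\<close>, namely
  \<open>D = \<partial>/\<partial>t + F \<partial>/\<partial>x + E \<partial>/\<partial>y\<close>; applying \<open>D\<close> to \<open>X, Y \<in> \<complex>(t)(x,y)\<close> rewrites the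
  system in the coordinates \<open>X, Y\<close>.
\<close>

definition time_derivation :: "(biratfun \<Rightarrow> biratfun) \<Rightarrow> bool" where
  "time_derivation D \<longleftrightarrow>
     (\<forall>u v. D (u + v) = D u + D v) \<and>
     (\<forall>u v. D (u * v) = D u * v + u * D v) \<and>
     (\<forall>c. D (emb (const c)) = 0) \<and>
     D (emb tvar) = 1"

definition system_S ::
  "complex \<Rightarrow> (nat \<Rightarrow> ratfun) \<Rightarrow> (biratfun \<Rightarrow> biratfun) \<Rightarrow> bool" where
  "system_S \<alpha>\<^sub>2 a D \<longleftrightarrow>
     time_derivation D \<and>
     (let A = (\<lambda>i. emb (a i)); al = emb (const \<alpha>\<^sub>2); x = xvar; y = yvar in
       D x = A 1 * x^3 * y + A 2 * x^2 * y + A 5 * x * y + A 7 * y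
             + (1/2) * ((3 * A 1 + 2 * A 3) * al - A 4) * x^2
             + ((A 2 + A 9) * al - A 6) * x + A 8 \<and>
       D y = A 3 * x^2 * y^2 + A 9 * x * y^2 + A 10 * y^2 + A 4 * x * y + A 6 * y
             + (1/2) * (A 1 * al + A 4) * al)"

datatype point = Finite ratfun | Infinity

fun chart :: "complex \<Rightarrow> point \<Rightarrow> biratfun \<times> biratfun" where
  "chart \<alpha>\<^sub>2 (Finite c) = (xvar - emb c, 1 / yvar)"
| "chart \<alpha>\<^sub>2 Infinity =
     (1 / xvar, 1 / (- (xvar * yvar + emb (const \<alpha>\<^sub>2)) * xvar))"

definition local_form ::
  "complex \<Rightarrow> (biratfun \<Rightarrow> biratfun) \<Rightarrow> point \<Rightarrow> bipoly \<Rightarrow> bipoly \<Rightarrow> bool" where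
  "local_form \<alpha>\<^sub>2 D p G H \<longleftrightarrow>
     (case chart \<alpha>\<^sub>2 p of (X, Y) \<Rightarrow> D X = eval2 G X Y / Y \<and> D Y = eval2 H X Y)"

text \<open>
  Both coordinates of a chart are algebraically independent over \<open>\<complex>(t)\<close>, so \<open>G\<close> and \<open>H\<close>
  below are determined by \<open>D\<close> and the point.
\<close>

definition accessible_singular_point ::
  "complex \<Rightarrow> (biratfun \<Rightarrow> biratfun) \<Rightarrow> point \<Rightarrow> bool" where
  "accessible_singular_point \<alpha>\<^sub>2 D p \<longleftrightarrow>
     (\<exists>G H. local_form \<alpha>\<^sub>2 D p G H \<and> coeff (coeff G 0) 0 = 0)"

definition linear_approximation ::
  "complex \<Rightarrow> (biratfun \<Rightarrow> biratfun) \<Rightarrow> point \<Rightarrow> ratfun^2^2 \<Rightarrow> bool" where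
  "linear_approximation \<alpha>\<^sub>2 D p M \<longleftrightarrow>
     (\<exists>G H. local_form \<alpha>\<^sub>2 D p G H \<and>
        coeff (coeff G 0) 0 = 0 \<and>
        M $ 1 $ 1 = coeff (coeff G 0) 1 \<and> M $ 1 $ 2 = coeff (coeff G 1) 0 \<and>
        M $ 2 $ 1 = 0 \<and> M $ 2 $ 2 = coeff (coeff H 0) 0)"

definition painleve_scheme ::
  "complex \<Rightarrow> (biratfun \<Rightarrow> biratfun) \<Rightarrow> (point \<times> (ratfun^2^2)) list \<Rightarrow> bool" where
  "painleve_scheme \<alpha>\<^sub>2 D S \<longleftrightarrow>
     (\<forall>(p, M) \<in> set S. accessible_singular_point \<alpha>\<^sub>2 D p \<and> linear_approximation \<alpha>\<^sub>2 D p M)"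

definition scheme_matrix :: "ratfun \<Rightarrow> complex \<Rightarrow> complex \<Rightarrow> ratfun^2^2" where
  "scheme_matrix f n \<alpha> =
     map_matrix (\<lambda>z. f * z) (vector [vector [const n, const \<alpha>], vector [0, 1]])"

end

theory Submission
  imports Defs
begin

text \<open>
  Write \<open>P = a\<^sub>1 x\<^sup>3 + a\<^sub>2 x\<^sup>2 + a\<^sub>5 x + a\<^sub>7\<close> for the coefficient of \<open>y\<close> in
  \<open>dx/dt\<close>, \<open>Q = B x\<^sup>2 + C x + a\<^sub>8\<close> for the part of \<open>dx/dt\<close> free of \<open>y\<close>, and
  \<open>R = a\<^sub>3 x\<^sup>2 + a\<^sub>9 x + a\<^sub>1\<^sub>0\<close> for the coefficient of \<open>y\<^sup>2\<close> in \<open>dy/dt\<close>.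
  In the chart \<open>(x - c, 1/y)\<close> one reads off that \<open>X = c\<close> is accessible iff \<open>P c = 0\<close>, and that the
  linear approximation then has the entries \<open>P' c\<close>, \<open>Q c - dc/dt\<close> and \<open>- R c\<close>.  In the
  chart at infinity they are \<open>a\<^sub>1\<close>, \<open>a\<^sub>1 \<alpha>\<^sub>2 - B\<close> and \<open>2 a\<^sub>1 + a\<^sub>3\<close>.

  So \<open>P = a\<^sub>1 x (x - 1) (x - t)\<close>.  If \<open>a\<^sub>1 \<noteq> 0\<close>, comparing the diagonal entries gives
  \<open>1/n = - R c / P' c\<close> at each finite point, and the three values sum to \<open>- a\<^sub>3 / a\<^sub>1\<close> by
  Lagrange interpolation of the quadratic \<open>R\<close> at the roots of \<open>P\<close>.  The fourth value is
  \<open>2 + a\<^sub>3 / a\<^sub>1\<close>, whence the total is \<open>2\<close> (\<open>sum_of_inverse_exponents\<close>).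

  If \<open>a\<^sub>1 = 0\<close>, then \<open>P = 0\<close> and all four factors \<open>f\<close> vanish because no \<open>n\<close> does, so the upper
  right entries vanish as well.  At infinity this says \<open>B = 0\<close>; at \<open>0\<close> and \<open>1\<close> it says that \<open>Q\<close>
  has these roots, so that \<open>Q = 0\<close>; but at \<open>t\<close>, which moves with speed \<open>1\<close>, it says \<open>Q t = 1\<close>.

  The linear approximation is specified through some local form of the system, so reading it off
  requires that local forms are unique (\<open>local_form_unique\<close>), which is the
  algebraic independence of the two coordinates of a chart.
\<close>

section \<open>The embeddings of the coefficient fields\<close>

lemma ratfun_two_nonzero: "(2 :: ratfun) \<noteq> 0"
proof -
  have "to_fract (1 + 1 :: complex poly) = 1 + 1"
    by (simp only: to_fract_add to_fract_1)
  moreover have "to_fract (1 + 1 :: complex poly) \<noteq> 0"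
    unfolding to_fract_eq_0_iff by simp
  ultimately show ?thesis by simp
qed

lemma emb_0 [simp]: "emb 0 = 0" and emb_1 [simp]: "emb 1 = 1"
  by (simp_all add: emb_def flip: one_pCons)

lemma emb_add [simp]: "emb (r + s) = emb r + emb s"
  by (simp add: emb_def flip: to_fract_add)

lemma emb_diff [simp]: "emb (r - s) = emb r - emb s"
  by (simp add: emb_def flip: to_fract_diff)

lemma emb_minus [simp]: "emb (- r) = - emb r"
  by (simp add: emb_def flip: to_fract_uminus)

lemma emb_mult [simp]: "emb (r * s) = emb r * emb s"
  by (simp add: emb_def flip: to_fract_mult)

lemma emb_eq_0_iff [simp]: "emb r = 0 \<longleftrightarrow> r = 0"
  by (simp add: emb_def)

lemma emb_power [simp]: "emb (r ^ k) = emb r ^ k"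
  by (induction k) simp_all

lemma emb_divide [simp]: "emb (r / s) = emb r / emb s"
proof (cases "s = 0")
  case False
  then have "emb (r / s) * emb s = emb r"
    by (simp flip: emb_mult)
  with False show ?thesis by (simp add: eq_divide_eq)
qed simp

lemma emb_2 [simp]: "emb 2 = 2" and emb_3 [simp]: "emb 3 = 3"
proof -
  show *: "emb 2 = 2" using emb_add[of 1 1] by (simp del: emb_add)
  show "emb 3 = 3" using emb_add[of 2 1] * by (simp del: emb_add)
qed

lemma biratfun_two_nonzero: "(2 :: biratfun) \<noteq> 0"
  using emb_eq_0_iff[of 2] ratfun_two_nonzero by simp

lemma const_add: "const (c + d) = const c + const d"
  by (simp add: const_def flip: to_fract_add)

lemma const_mult: "const (c * d) = const c * const d"
  by (simp add: const_def flip: to_fract_mult)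

lemma const_0 [simp]: "const 0 = 0" and const_1 [simp]: "const 1 = 1"
  by (simp_all add: const_def flip: one_pCons)

lemma const_2: "const 2 = 2"
  using const_add[of 1 1] by simp

lemma const_eq_iff [simp]: "const c = const d \<longleftrightarrow> c = d"
  by (simp add: const_def)

lemma const_inverse: "const (1 / c) = 1 / const c"
proof (cases "c = 0")
  case False
  then have "const (1 / c) * const c = 1" 
    by (simp flip: const_mult)
  moreover have "const c \<noteq> 0" using False const_eq_iff[of c 0] by simp
  ultimately show ?thesis by (simp add: eq_divide_eq)
qed simp

lemma xvar_nonzero: "xvar \<noteq> 0" and yvar_nonzero: "yvar \<noteq> 0"
  by (simp_all add: xvar_def yvar_def)

section \<open>Algebraic independence of chart coordinates\<close>

definition eval1 :: "biratfun \<Rightarrow> ratfun poly \<Rightarrow> biratfun" where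
  "eval1 X p = poly (map_poly emb p) X"

lemma eval1_0 [simp]: "eval1 X 0 = 0"
  by (simp add: eval1_def)

lemma eval1_pCons [simp]: "eval1 X (pCons c p) = emb c + X * eval1 X p"
  by (simp add: eval1_def map_poly_pCons)

lemma eval1_diff: "eval1 X (p - q) = eval1 X p - eval1 X q"
proof -
  have "map_poly emb (p - q) = map_poly emb p - map_poly emb q"
    by (rule poly_eqI) (simp add: coeff_map_poly)
  then show ?thesis by (simp add: eval1_def)
qed

lemma eval2_0 [simp]: "eval2 0 X Y = 0"
  by (simp add: eval2_def)

lemma eval2_pCons [simp]: "eval2 (pCons p G) X Y = eval1 X p + Y * eval2 G X Y"
  by (simp add: eval2_def map_poly_pCons flip: eval1_def)

lemma eval2_diff: "eval2 (G - H) X Y = eval2 G X Y - eval2 H X Y"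
proof -
  have "map_poly (eval1 X) (G - H) = map_poly (eval1 X) G - map_poly (eval1 X) H"
    by (rule poly_eqI) (simp add: coeff_map_poly eval1_diff)
  then show ?thesis by (simp add: eval2_def flip: eval1_def)
qed

lemma eval2_conv_sum:
  "eval2 G X Y = (\<Sum>j\<le>degree G. eval1 X (coeff G j) * Y ^ j)"
proof -
  have "map_poly (eval1 X) G = (\<Sum>j\<le>degree G. monom (eval1 X (coeff G j)) j)"
    by (rule poly_eqI) (simp add: coeff_sum coeff_map_poly coeff_eq_0)
  then show ?thesis
    by (simp add: eval2_def poly_sum poly_monom flip: eval1_def)
qed

lemma eval1_xvar: "eval1 xvar p = to_fract [:p:]"
  by (induction p) (simp_all add: xvar_def emb_def flip: to_fract_mult to_fract_add)

lemma eval1_shifted_xvar: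
  "eval1 (xvar - emb c) p = to_fract [:pcompose p [:- c, 1:]:]"
proof (induction p)
  case (pCons b p)
  have X: "xvar - emb c = to_fract [:[:- c, 1:]:]"
    by (simp add: xvar_def emb_def flip: to_fract_diff)
  have "eval1 (xvar - emb c) (pCons b p)
      = to_fract [:[:b:]:] + to_fract [:[:- c, 1:]:] * to_fract [:pcompose p [:- c, 1:]:]"
    by (simp only: eval1_pCons pCons.IH emb_def[of b] flip: X)
  also have "\<dots> = to_fract ([:[:b:]:] + [:[:- c, 1:]:] * [:pcompose p [:- c, 1:]:])"
    by (simp only: to_fract_add to_fract_mult)
  also have "[:[:b:]:] + [:[:- c, 1:]:] * [:pcompose p [:- c, 1:]:]
      = [:pcompose (pCons b p) [:- c, 1:]:]"
    by (simp add: pcompose_pCons)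
  finally show ?case .
qed simp

text \<open>
  Clearing denominators in \<open>p (1/x)\<close> reverses the coefficients of \<open>p\<close>.  The exponent \<open>m\<close> may
  exceed the degree so that all coefficients of a polynomial in two variables can be cleared by one
  common power.
\<close>

lemma eval1_inverse_xvar:
  assumes "degree p \<le> m"
  shows "eval1 (1 / xvar) p * xvar ^ m = to_fract [:monom 1 (m - degree p) * reflect_poly p:]"
proof -
  have deg: "degree (map_poly emb p) = degree p"
    by (rule degree_map_poly) simp
  have "map_poly emb (reflect_poly p) = reflect_poly (map_poly emb p)"
    by (rule poly_eqI) (simp add: coeff_map_poly coeff_reflect_poly deg)
  then have "to_fract [:reflect_poly p:] = xvar ^ degree p * eval1 (1 / xvar) p"
    using poly_reflect_poly_nz[OF xvar_nonzero, of "map_poly emb p"]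
    by (simp add: eval1_def deg inverse_eq_divide flip: eval1_xvar)
  moreover have "to_fract [:monom 1 k:] = xvar ^ k" for k
  proof (induction k)
    case (Suc k)
    have "[:monom 1 (Suc k):] = [:[:0, 1:]:] * [:monom 1 k :: ratfun poly:]"
      by (simp add: monom_Suc)
    then have "to_fract [:monom 1 (Suc k):] = xvar * to_fract [:monom 1 k:]"
      by (simp only: xvar_def to_fract_mult)
    with Suc.IH show ?case by simp
  qed (simp flip: one_pCons)
  ultimately have "to_fract ([:monom 1 (m - degree p):] * [:reflect_poly p:])
    = xvar ^ (m - degree p) * (xvar ^ degree p * eval1 (1 / xvar) p)"
    by (simp del: mult_pCons_left mult_pCons_right)
  also have "\<dots> = eval1 (1 / xvar) p * xvar ^ (m - degree p + degree p)"
    by (simp add: power_add)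
  also have "\<dots> = eval1 (1 / xvar) p * xvar ^ m" using assms by simp
  finally show ?thesis by (simp add: mult.commute)
qed

text \<open>
  In both kinds of charts the second coordinate is the inverse of a polynomial \<open>V\<close> of positive
  degree in \<open>y\<close>, and the first one lies in \<open>\<complex>(t)(x)\<close> and is transcendental, with denominators cleared
  by powers of \<open>W\<close>.  Multiplying a relation \<open>G(X, 1/V) = 0\<close> by powers of \<open>W\<close> and \<open>V\<close> turns it into
  \<open>q(V) = 0\<close> for a polynomial \<open>q\<close> over \<open>\<complex>(t)[x]\<close>, whose coefficients must vanish because the degree
  in \<open>y\<close> of the composition is multiplicative.
\<close>

lemma eval2_eq_0_imp_eq_0:
  fixes V :: bipoly
  assumes clear: "\<And>p m. degree p \<le> m \<Longrightarrow>
      \<exists>u. (u = 0 \<longrightarrow> p = 0) \<and> eval1 X p * W ^ m = to_fract [:u:]"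
    and V: "degree V > 0"
    and zero: "eval2 G X (1 / to_fract V) = 0"
  shows "G = 0"
proof -
  define N where "N = degree G"
  define m where "m = (\<Sum>j\<le>N. degree (coeff G j))"
  have "degree (coeff G j) \<le> m" if "j \<le> N" for j
    unfolding m_def using that by (intro member_le_sum) auto
  then have "\<forall>j\<le>N. \<exists>u. (u = 0 \<longrightarrow> coeff G j = 0) \<and> eval1 X (coeff G j) * W ^ m = to_fract [:u:]"
    using clear by blast
  then obtain u where u: "\<And>j. j \<le> N \<Longrightarrow> u j = 0 \<Longrightarrow> coeff G j = 0"
      "\<And>j. j \<le> N \<Longrightarrow> eval1 X (coeff G j) * W ^ m = to_fract [:u j:]"
    by metis
  have V0: "to_fract V \<noteq> 0" using V by auto
  \<comment> \<open>The coefficients are reversed: the relation is a polynomial in \<open>1/V\<close>, and \<open>q\<close> is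
      to be evaluated at \<open>V\<close>.\<close>
  define q where "q = (\<Sum>j\<le>N. monom (u j) (N - j))"
  have V_pow: "(1 / to_fract V) ^ j * to_fract V ^ N = to_fract (V ^ (N - j))" if "j \<le> N" for j
  proof -
    have "to_fract V ^ N = to_fract V ^ j * to_fract V ^ (N - j)"
      using that by (simp flip: power_add)
    moreover have "to_fract (V ^ k) = to_fract V ^ k" for k
      by (induction k) simp_all
    ultimately show ?thesis using V0 by (simp add: power_divide)
  qed
  have monom: "pcompose (monom c k) V = [:c:] * V ^ k" for c k
    by (induction k) (simp_all add: monom_Suc monom_0 pcompose_pCons algebra_simps)
  have "to_fract (pcompose q V) = (\<Sum>j\<le>N. to_fract [:u j:] * to_fract (V ^ (N - j)))"
    by (simp add: q_def pcompose_sum monom flip: to_fract_mult)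
  also have "\<dots> = (\<Sum>j\<le>N. (eval1 X (coeff G j) * W ^ m) * ((1 / to_fract V) ^ j * to_fract V ^ N))"
    by (intro sum.cong refl) (simp only: atMost_iff u V_pow)
  also have "\<dots> = eval2 G X (1 / to_fract V) * (W ^ m * to_fract V ^ N)"
    unfolding eval2_conv_sum sum_distrib_right N_def[symmetric]
    by (intro sum.cong refl) (simp only: mult_ac)
  also have "\<dots> = 0" using zero by simp
  finally have q0: "q = 0" using pcompose_eq_0[OF _ V] by simp
  have "coeff G j = 0" for j
  proof (cases "j \<le> N")
    case True
    have "coeff q (N - j) = (\<Sum>i\<le>N. if i = j then u i else 0)"
      unfolding q_def coeff_sum using True by (intro sum.cong refl) (auto simp: coeff_monom)
    then have "u j = 0" using q0 True by simp
    then show ?thesis using u(1) True by blast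
  qed (simp add: coeff_eq_0 N_def)
  then show ?thesis by (simp add: poly_eq_iff)
qed

lemma infinity_chart_denominator:
  "- (xvar * yvar + emb (const \<alpha>)) * xvar
     = to_fract [:[:0, - const \<alpha>:], [:0, 0, - 1:]:]"
  by (simp add: xvar_def yvar_def emb_def flip: to_fract_mult to_fract_add to_fract_uminus)

lemma chart_algebraically_independent:
  assumes "chart \<alpha> p = (X, Y)" and "eval2 G X Y = 0"
  shows "G = 0"
proof (cases p)
  case (Finite c)
  have "\<exists>u. (u = 0 \<longrightarrow> q = 0) \<and> eval1 (xvar - emb c) q * 1 ^ m = to_fract [:u:]" for q m
    by (rule exI[of _ "pcompose q [:- c, 1:]"])
       (use pcompose_eq_0[of q "[:- c, 1:]"] in \<open>simp add: eval1_shifted_xvar\<close>)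
  moreover have "degree ([:0, 1:] :: bipoly) > 0" by simp
  moreover have "eval2 G (xvar - emb c) (1 / to_fract [:0, 1:]) = 0"
    using assms Finite by (simp add: yvar_def)
  ultimately show ?thesis by (rule eval2_eq_0_imp_eq_0)
next
  case Infinity
  have "\<exists>u. (u = 0 \<longrightarrow> q = 0) \<and> eval1 (1 / xvar) q * xvar ^ m = to_fract [:u:]"
    if "degree q \<le> m" for q m
    by (rule exI[of _ "monom 1 (m - degree q) * reflect_poly q"])
       (use eval1_inverse_xvar[OF that] in \<open>simp add: monom_eq_0_iff\<close>)
  moreover have "degree ([:[:0, - const \<alpha>:], [:0, 0, - 1:]:] :: bipoly) > 0" by simp
  moreover have "eval2 G (1 / xvar) (1 / to_fract [:[:0, - const \<alpha>:], [:0, 0, - 1:]:]) = 0"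
    using assms Infinity infinity_chart_denominator[of \<alpha>] by auto
  ultimately show ?thesis by (rule eval2_eq_0_imp_eq_0)
qed

lemma infinity_chart_factor_nonzero: "xvar * yvar + emb (const \<alpha>) \<noteq> 0"
proof
  assume "xvar * yvar + emb (const \<alpha>) = 0"
  then have "to_fract [:[:0, - const \<alpha>:], [:0, 0, - 1:]:] = (0 :: biratfun)"
    by (simp only: minus_zero mult_zero_left flip: infinity_chart_denominator)
  then show False by simp
qed

lemma local_form_unique:
  assumes "local_form \<alpha> D p G H" and "local_form \<alpha> D p G' H'"
  shows "G = G'" and "H = H'"
proof -
  obtain X Y where XY: "chart \<alpha> p = (X, Y)" by fastforce
  have "Y \<noteq> 0"
    using XY xvar_nonzero yvar_nonzero infinity_chart_factor_nonzero[of \<alpha>]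
    by (cases p) (auto simp: eq_divide_eq neg_eq_iff_add_eq_0)
  then have "eval2 (G - G') X Y = 0" "eval2 (H - H') X Y = 0"
    using assms XY by (auto simp: local_form_def eval2_diff)
  then show "G = G'" "H = H'"
    using chart_algebraically_independent[OF XY] by (metis eq_iff_diff_eq_0)+
qed

section \<open>Derivations\<close>

context
  fixes D assumes D: "time_derivation D"
begin

lemma derivation_add: "D (u + v) = D u + D v"
  and derivation_mult: "D (u * v) = D u * v + u * D v"
  using D by (simp_all add: time_derivation_def)

lemma derivation_0: "D 0 = 0"
  using derivation_add[of 0 0] by (simp only: add_0_left add_cancel_right_right)

lemma derivation_1: "D 1 = 0"
  using derivation_mult[of 1 1] by (simp only: mult_1_left mult_1_right add_cancel_right_right)

lemma derivation_const: "D (emb (const c)) = 0"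
  using D by (simp add: time_derivation_def)

lemma derivation_tvar: "D (emb tvar) = 1"
  using D by (simp add: time_derivation_def)

lemma derivation_minus: "D (- u) = - D u"
  using derivation_add[of u "- u"] derivation_0 by (simp add: eq_neg_iff_add_eq_0 add.commute)

lemma derivation_diff: "D (u - v) = D u - D v"
  using derivation_add[of u "- v"] by (simp add: derivation_minus)

lemma derivation_inverse:
  assumes "u \<noteq> 0"
  shows "D (1 / u) = - D u / u ^ 2"
proof -
  have "D (1 / u) * u + (1 / u) * D u = 0"
    using derivation_mult[of "1 / u" u] derivation_1 assms by simp
  then show ?thesis using assms by (simp add: field_simps power2_eq_square eq_neg_iff_add_eq_0)
qed

end

section \<open>The system in the local charts\<close>

definition coeff_x2 :: "complex \<Rightarrow> (nat \<Rightarrow> ratfun) \<Rightarrow> ratfun" where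
  "coeff_x2 \<alpha> a = ((3 * a 1 + 2 * a 3) * const \<alpha> - a 4) / 2"

definition coeff_x1 :: "complex \<Rightarrow> (nat \<Rightarrow> ratfun) \<Rightarrow> ratfun" where
  "coeff_x1 \<alpha> a = (a 2 + a 9) * const \<alpha> - a 6"

text \<open>
  The rows are the Taylor expansions at \<open>x = c\<close> of \<open>P\<close> and of \<open>Q - d\<close>, where \<open>d\<close> stands for
  \<open>dc/dt\<close>: with \<open>Y = 1/y\<close> one has \<open>dX/dt = P/Y + Q - d\<close>.
\<close>

definition finite_G :: "complex \<Rightarrow> (nat \<Rightarrow> ratfun) \<Rightarrow> ratfun \<Rightarrow> ratfun \<Rightarrow> bipoly" where
  "finite_G \<alpha> a c d =
     [:[:a 1 * c^3 + a 2 * c^2 + a 5 * c + a 7, 3 * a 1 * c^2 + 2 * a 2 * c + a 5,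
         3 * a 1 * c + a 2, a 1:],
       [:coeff_x2 \<alpha> a * c^2 + coeff_x1 \<alpha> a * c + a 8 - d,
         2 * coeff_x2 \<alpha> a * c + coeff_x1 \<alpha> a, coeff_x2 \<alpha> a:]:]"

text \<open>
  From \<open>dY/dt = - Y\<^sup>2 dy/dt\<close>, expanded at \<open>x = c\<close>.
\<close>

definition finite_H :: "complex \<Rightarrow> (nat \<Rightarrow> ratfun) \<Rightarrow> ratfun \<Rightarrow> bipoly" where
  "finite_H \<alpha> a c =
     - [:[:a 3 * c^2 + a 9 * c + a 10, 2 * a 3 * c + a 9, a 3:],
         [:a 4 * c + a 6, a 4:],
         [:(a 1 * const \<alpha> + a 4) * const \<alpha> / 2:]:]"

text \<open>
  With \<open>s = x y + \<alpha>\<^sub>2 = - X/Y\<close> one has \<open>y = (s - \<alpha>\<^sub>2) X\<close>, and \<open>dX/dt = - X\<^sup>2 dx/dt\<close> becomes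
  \<open>(a\<^sub>1 + a\<^sub>2 X + a\<^sub>5 X\<^sup>2 + a\<^sub>7 X\<^sup>3) (X/Y + \<alpha>\<^sub>2) - (B + C X + a\<^sub>8 X\<^sup>2)\<close>.
\<close>

definition infinity_G :: "complex \<Rightarrow> (nat \<Rightarrow> ratfun) \<Rightarrow> bipoly" where
  "infinity_G \<alpha> a =
     [:[:0, a 1, a 2, a 5, a 7:],
       [:const \<alpha> * a 1 - coeff_x2 \<alpha> a, const \<alpha> * a 2 - coeff_x1 \<alpha> a,
         const \<alpha> * a 5 - a 8, const \<alpha> * a 7:]:]"

text \<open>
  This is the quotient by \<open>X\<^sup>2\<close> of
  \<open>(2 P + R) (X + \<alpha>\<^sub>2 Y)\<^sup>2 - (\<alpha>\<^sub>2 P + 2 Q + T) Y (X + \<alpha>\<^sub>2 Y) + (\<alpha>\<^sub>2 Q + e) Y\<^sup>2\<close>,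
  where \<open>P\<close>, \<open>Q\<close>, \<open>R\<close> and \<open>T = a\<^sub>4 + a\<^sub>6 X\<close> have reversed coefficients and \<open>e\<close> is the
  constant term of \<open>dy/dt\<close>.  The shape of \<open>B\<close>, \<open>C\<close> and \<open>e\<close> in the system is exactly what makes the
  terms of degree less than \<open>2\<close> in \<open>X\<close> cancel.
\<close>

definition infinity_H :: "complex \<Rightarrow> (nat \<Rightarrow> ratfun) \<Rightarrow> bipoly" where
  "infinity_H \<alpha> a =
     [:[:2 * a 1 + a 3, 2 * a 2 + a 9, 2 * a 5 + a 10, 2 * a 7:],
       [:const \<alpha> * a 2 + a 6, 3 * const \<alpha> * a 5 + 2 * const \<alpha> * a 10 - 2 * a 8,
         3 * const \<alpha> * a 7:],
       [:const \<alpha> ^ 2 * (a 5 + a 10) - const \<alpha> * a 8, const \<alpha> ^ 2 * a 7:]:]"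

lemma system_S_derivatives:
  assumes "system_S \<alpha> a D"
  shows "D xvar = yvar * (emb (a 1) * xvar^3 + emb (a 2) * xvar^2 + emb (a 5) * xvar + emb (a 7))
            + emb (coeff_x2 \<alpha> a) * xvar^2 + emb (coeff_x1 \<alpha> a) * xvar + emb (a 8)"
    and "D yvar = yvar^2 * (emb (a 3) * xvar^2 + emb (a 9) * xvar + emb (a 10))
            + yvar * (emb (a 4) * xvar + emb (a 6))
            + emb ((a 1 * const \<alpha> + a 4) * const \<alpha> / 2)"
proof -
  have B: "emb (coeff_x2 \<alpha> a) = 1/2 * ((3 * emb (a 1) + 2 * emb (a 3)) * emb (const \<alpha>) - emb (a 4))"
    by (simp add: coeff_x2_def)
  have C: "emb (coeff_x1 \<alpha> a) = (emb (a 2) + emb (a 9)) * emb (const \<alpha>) - emb (a 6)"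
    by (simp add: coeff_x1_def)
  have e: "emb ((a 1 * const \<alpha> + a 4) * const \<alpha> / 2)
      = 1/2 * (emb (a 1) * emb (const \<alpha>) + emb (a 4)) * emb (const \<alpha>)"
    by simp
  show "D xvar = yvar * (emb (a 1) * xvar^3 + emb (a 2) * xvar^2 + emb (a 5) * xvar + emb (a 7))
            + emb (coeff_x2 \<alpha> a) * xvar^2 + emb (coeff_x1 \<alpha> a) * xvar + emb (a 8)"
    using assms unfolding system_S_def Let_def B C by (auto simp only: ring_distribs mult_ac)
  show "D yvar = yvar^2 * (emb (a 3) * xvar^2 + emb (a 9) * xvar + emb (a 10))
            + yvar * (emb (a 4) * xvar + emb (a 6))
            + emb ((a 1 * const \<alpha> + a 4) * const \<alpha> / 2)"
    using assms unfolding system_S_def Let_def e by (auto simp only: ring_distribs mult_ac add_ac)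
qed

lemma local_form_finite:
  assumes S: "system_S \<alpha> a D" and d: "D (emb c) = emb d"
  shows "local_form \<alpha> D (Finite c) (finite_G \<alpha> a c d) (finite_H \<alpha> a c)"
proof -
  have D: "time_derivation D" using S by (simp add: system_S_def)
  have "D (xvar - emb c) = eval2 (finite_G \<alpha> a c d) (xvar - emb c) (1 / yvar) / (1 / yvar)"
    unfolding derivation_diff[OF D] d system_S_derivatives(1)[OF S] finite_G_def
    using yvar_nonzero
    by (simp add: field_simps power2_eq_square power3_eq_cube)
  moreover have "D (1 / yvar) = eval2 (finite_H \<alpha> a c) (xvar - emb c) (1 / yvar)"
    unfolding derivation_inverse[OF D yvar_nonzero] system_S_derivatives(2)[OF S] finite_H_def
    using yvar_nonzero
    by (simp add: field_simps power2_eq_square power3_eq_cube)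
  ultimately show ?thesis by (simp add: local_form_def)
qed


lemma local_form_infinity:
  assumes S: "system_S \<alpha> a D"
  shows "local_form \<alpha> D Infinity (infinity_G \<alpha> a) (infinity_H \<alpha> a)"
proof -
  have D: "time_derivation D" using S by (simp add: system_S_def)
  define x y A s where "x = xvar" and "y = yvar" and "A = emb (const \<alpha>)" and "s = x * y + A"
  define B C e where "B = emb (coeff_x2 \<alpha> a)" and "C = emb (coeff_x1 \<alpha> a)"
    and "e = emb ((a 1 * const \<alpha> + a 4) * const \<alpha> / 2)"
  define b where "b i = emb (a i)" for i
  have x: "x \<noteq> 0" and s: "s \<noteq> 0"
    using xvar_nonzero infinity_chart_factor_nonzero by (simp_all add: x_def s_def y_def A_def)
  \<comment> \<open>Eliminating \<open>y\<close> makes both sides rational in \<open>x\<close> and \<open>s\<close>, which are nonzero, so that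
      clearing denominators leaves polynomial identities.\<close>
  have y: "y = (s - A) / x" using x by (simp add: s_def)
  have B2: "2 * B = (3 * b 1 + 2 * b 3) * A - b 4" 
    using biratfun_two_nonzero by (simp add: B_def coeff_x2_def b_def A_def)
  have C: "C = (b 2 + b 9) * A - b 6" by (simp add: C_def coeff_x1_def b_def A_def)
  have e2: "2 * e = (b 1 * A + b 4) * A" 
    using biratfun_two_nonzero by (simp add: e_def b_def A_def)
  \<comment> \<open>The divisions by \<open>2\<close> in the system are eliminated by keeping \<open>B\<close> and expressing
      \<open>a\<^sub>4\<close> and \<open>e\<close> through it.\<close>
  have e: "e = A * B + A * b 4 - A ^ 2 * b 1 - A ^ 2 * b 3"
  proof -
    have "2 * e = 2 * (A * B + A * b 4 - A ^ 2 * b 1 - A ^ 2 * b 3)"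
      using B2 e2 by algebra
    then show ?thesis
      unfolding mult_left_cancel[OF biratfun_two_nonzero] .
  qed
  have b4: "b 4 = (3 * b 1 + 2 * b 3) * A - 2 * B" using B2 by algebra
  have Dx: "D x = y * (b 1 * x^3 + b 2 * x^2 + b 5 * x + b 7) + B * x^2 + C * x + b 8"
    using system_S_derivatives(1)[OF S] by (simp add: x_def y_def b_def B_def C_def)
  have Dy: "D y = y^2 * (b 3 * x^2 + b 9 * x + b 10) + y * (b 4 * x + b 6) + e"
    using system_S_derivatives(2)[OF S] by (simp add: x_def y_def b_def e_def)
  have DA: "D A = 0" by (simp add: A_def derivation_const[OF D])
  have Dden: "D (- s * x) = - ((D x * y + x * D y) * x + s * D x)"
  proof -
    have "D s = D x * y + x * D y"
      by (simp add: s_def derivation_mult[OF D] derivation_add[OF D] DA)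
    then show ?thesis
      unfolding derivation_mult[OF D] derivation_minus[OF D] by (simp add: algebra_simps)
  qed
  have "D (1 / x) = eval2 (infinity_G \<alpha> a) (1 / x) (1 / (- s * x)) / (1 / (- s * x))"
    unfolding derivation_inverse[OF D x] Dx infinity_G_def y
    using x s
    by (simp add: divide_simps power2_eq_square power3_eq_cube flip: b_def A_def B_def C_def)
       algebra
  moreover have "D (1 / (- s * x)) = eval2 (infinity_H \<alpha> a) (1 / x) (1 / (- s * x))"
  proof -
    have "- s * x \<noteq> 0" using x s by simp
    then show ?thesis
      unfolding derivation_inverse[OF D \<open>- s * x \<noteq> 0\<close>] Dden Dx Dy infinity_H_def
      unfolding y C e b4
      using x s
      by (simp add: divide_simps power2_eq_square power3_eq_cube flip: b_def A_def B_def C_def)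
         algebra
  qed
  ultimately show ?thesis
    by (simp add: local_form_def x_def s_def y_def A_def)
qed


section \<open>Conditions imposed by the Painleve scheme\<close>

lemma linear_approximation_entries:
  assumes "local_form \<alpha> D p G H" and "linear_approximation \<alpha> D p M"
  shows "coeff (coeff G 0) 0 = 0" and "M $ 1 $ 1 = coeff (coeff G 0) 1"
    and "M $ 1 $ 2 = coeff (coeff G 1) 0" and "M $ 2 $ 2 = coeff (coeff H 0) 0"
  using assms local_form_unique[OF assms(1)] unfolding linear_approximation_def by metis+

lemma scheme_matrix_entries:
  "scheme_matrix f n \<alpha> $ 1 $ 1 = f * const n"
  "scheme_matrix f n \<alpha> $ 1 $ 2 = f * const \<alpha>"
  "scheme_matrix f n \<alpha> $ 2 $ 2 = f"
  by (simp_all add: scheme_matrix_def)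

lemma finite_point_conditions:
  assumes S: "system_S \<alpha> a D" and d: "D (emb c) = emb d"
    and L: "linear_approximation \<alpha> D (Finite c) (scheme_matrix f n \<beta>)"
  shows "a 1 * c^3 + a 2 * c^2 + a 5 * c + a 7 = 0"
    and "f * const n = 3 * a 1 * c^2 + 2 * a 2 * c + a 5"
    and "f * const \<beta> = coeff_x2 \<alpha> a * c^2 + coeff_x1 \<alpha> a * c + a 8 - d"
    and "f = - (a 3 * c^2 + a 9 * c + a 10)"
  using linear_approximation_entries[OF local_form_finite[OF S d] L]
  by (simp_all add: finite_G_def finite_H_def scheme_matrix_entries)

lemma infinity_conditions:
  assumes S: "system_S \<alpha> a D"
    and L: "linear_approximation \<alpha> D Infinity (scheme_matrix f n \<beta>)"
  shows "f * const n = a 1"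
    and "f * const \<beta> = const \<alpha> * a 1 - coeff_x2 \<alpha> a"
    and "f = 2 * a 1 + a 3"
  using linear_approximation_entries[OF local_form_infinity[OF S] L]
  by (simp_all add: infinity_G_def infinity_H_def scheme_matrix_entries)

lemma cubic_with_roots_0_1_t:
  fixes a b c d t :: "'a :: field"
  assumes "d = 0" and "a + b + c + d = 0" and "a * t^3 + b * t^2 + c * t + d = 0"
    and "t \<noteq> 0" and "t \<noteq> 1"
  shows "b = - a * (1 + t)" and "c = a * t"
proof -
  have "t * (t - 1) * (a * (1 + t) + b) = 0" using assms(1-3) by algebra
  then have "a * (1 + t) + b = 0" using assms(4,5) by simp
  then show "b = - a * (1 + t)" "c = a * t" using assms(1-3) by algebra+
qed

text \<open>
  Here \<open>a1 * (X\<^sup>3 - (1 + t) * X\<^sup>2 + t * X)\<close> is the cubic \<open>P\<close> and \<open>r\<close> the quadratic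
  \<open>R\<close> of the introduction.  Each \<open>1 / n\<close> at a finite point \<open>c\<close> is \<open>- r c / P' c\<close>, so their sum
  is a Lagrange interpolation sum, namely minus the leading coefficient of \<open>r\<close> over that of
  \<open>P\<close>.
\<close>

lemma sum_of_inverse_exponents:
  fixes a1 a3 a9 a10 t n1 n2 n3 n4 :: "'a :: field"
  assumes t: "t \<noteq> 0" "t \<noteq> 1" and a1: "a1 \<noteq> 0"
    and 0: "- a10 * n1 = a1 * t"
    and 1: "- (a3 + a9 + a10) * n2 = a1 * (1 - t)"
    and 2: "- (a3 * t^2 + a9 * t + a10) * n3 = a1 * (t * (t - 1))"
    and 3: "(2 * a1 + a3) * n4 = a1"
  shows "1 / n1 + 1 / n2 + 1 / n3 + 1 / n4 = 2"
proof -
  define r where "r c = a3 * c^2 + a9 * c + a10" for c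
  have reciprocal: "1 / m = s / p" if "s * m = p" "p \<noteq> 0" for s m p :: 'a
    using that by auto
  have "1 / n1 = - r 0 / (a1 * t)"
    by (rule reciprocal) (use 0 t a1 in \<open>simp_all add: r_def\<close>)
  moreover have "1 / n2 = - r 1 / (a1 * (1 - t))"
    by (rule reciprocal) (use 1 t a1 in \<open>simp_all add: r_def\<close>)
  moreover have "1 / n3 = - r t / (a1 * (t * (t - 1)))"
    by (rule reciprocal) (use 2 t a1 in \<open>simp_all add: r_def\<close>)
  moreover have "1 / n4 = (2 * a1 + a3) / a1"
    by (rule reciprocal) (use 3 a1 in simp_all)
  moreover have "- r 0 / (a1 * t) + - r 1 / (a1 * (1 - t)) + - r t / (a1 * (t * (t - 1))) = - a3 / a1"
    using t t(2)[symmetric] a1 by (simp add: r_def divide_simps) algebra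
  ultimately show ?thesis using a1 by (simp add: add_divide_distrib)
qed

section \<open>The relation between the exponents\<close>

lemma tvar_nontrivial: "tvar \<noteq> 0" "tvar \<noteq> 1"
proof -
  show "tvar \<noteq> 0" by (simp add: tvar_def)
  have "tvar = to_fract 1 \<Longrightarrow> False" unfolding tvar_def to_fract_eq_iff by (simp add: one_pCons)
  then show "tvar \<noteq> 1" by auto
qed

theorem proposition4p3:
  fixes n\<^sub>1 n\<^sub>2 n\<^sub>3 n\<^sub>4 \<alpha>\<^sub>0 \<alpha>\<^sub>1 \<alpha>\<^sub>2 \<alpha>\<^sub>3 \<alpha>\<^sub>4 :: complex
    and a :: "nat \<Rightarrow> ratfun"
    and f\<^sub>0 f\<^sub>1 f\<^sub>2 f\<^sub>3 :: ratfun
    and D :: "biratfun \<Rightarrow> biratfun"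
  assumes "n\<^sub>1 \<noteq> 0" and "n\<^sub>2 \<noteq> 0" and "n\<^sub>3 \<noteq> 0" and "n\<^sub>4 \<noteq> 0"
    and "system_S \<alpha>\<^sub>2 a D"
    and "painleve_scheme \<alpha>\<^sub>2 D
           [(Finite 0,    scheme_matrix f\<^sub>0 n\<^sub>1 \<alpha>\<^sub>4),
            (Finite 1,    scheme_matrix f\<^sub>1 n\<^sub>2 \<alpha>\<^sub>3),
            (Finite tvar, scheme_matrix f\<^sub>2 n\<^sub>3 \<alpha>\<^sub>0),
            (Infinity,    scheme_matrix f\<^sub>3 n\<^sub>4 \<alpha>\<^sub>1)]"
  shows "1 / n\<^sub>1 + 1 / n\<^sub>2 + 1 / n\<^sub>3 + 1 / n\<^sub>4 = 2"
proof -
  note S = assms(5)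
  have D: "time_derivation D" using S by (simp add: system_S_def)
  have d: "D (emb 0) = emb 0" "D (emb 1) = emb 0" "D (emb tvar) = emb 1"
    by (simp_all add: derivation_0[OF D] derivation_1[OF D] derivation_tvar[OF D])
  have L: "linear_approximation \<alpha>\<^sub>2 D (Finite 0) (scheme_matrix f\<^sub>0 n\<^sub>1 \<alpha>\<^sub>4)"
      "linear_approximation \<alpha>\<^sub>2 D (Finite 1) (scheme_matrix f\<^sub>1 n\<^sub>2 \<alpha>\<^sub>3)"
      "linear_approximation \<alpha>\<^sub>2 D (Finite tvar) (scheme_matrix f\<^sub>2 n\<^sub>3 \<alpha>\<^sub>0)"
      "linear_approximation \<alpha>\<^sub>2 D Infinity (scheme_matrix f\<^sub>3 n\<^sub>4 \<alpha>\<^sub>1)"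
    using assms(6) by (auto simp: painleve_scheme_def)
  note at0 = finite_point_conditions[OF S d(1) L(1)]
  note at1 = finite_point_conditions[OF S d(2) L(2)]
  note att = finite_point_conditions[OF S d(3) L(3)]
  note inf = infinity_conditions[OF S L(4)]
  note t = tvar_nontrivial
  have n: "const n\<^sub>1 \<noteq> 0" "const n\<^sub>2 \<noteq> 0" "const n\<^sub>3 \<noteq> 0" "const n\<^sub>4 \<noteq> 0"
    using assms(1-4) const_eq_iff[of _ 0] by auto
  have a2: "a 2 = - a 1 * (1 + tvar)" and a5: "a 5 = a 1 * tvar"
    using cubic_with_roots_0_1_t[of "a 7" "a 1" "a 2" "a 5" tvar] at0(1) at1(1) att(1) t by simp_all
  have 0: "f\<^sub>0 * const n\<^sub>1 = a 1 * tvar"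
    using at0(2) a5 by simp
  have 1: "f\<^sub>1 * const n\<^sub>2 = a 1 * (1 - tvar)"
    unfolding at1(2) a2 a5 by (simp add: algebra_simps)
  have 2: "f\<^sub>2 * const n\<^sub>3 = a 1 * (tvar * (tvar - 1))"
    unfolding att(2) a2 a5 by (simp add: algebra_simps power2_eq_square)
  \<comment> \<open>For \<open>a 1 = 0\<close> the diagonal entries say nothing about the exponents, and only the
      upper right entries, with the moving point \<open>t\<close>, give a contradiction.\<close>
  have "a 1 \<noteq> 0"
  proof
    assume a1: "a 1 = 0"
    then have "f\<^sub>0 = 0" "f\<^sub>1 = 0" "f\<^sub>2 = 0" "f\<^sub>3 = 0"
      using 0 1 2 inf(1) n by auto
    then have "coeff_x2 \<alpha>\<^sub>2 a = 0" "a 8 = 0" "coeff_x2 \<alpha>\<^sub>2 a + coeff_x1 \<alpha>\<^sub>2 a + a 8 = 0"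
      "coeff_x2 \<alpha>\<^sub>2 a * tvar^2 + coeff_x1 \<alpha>\<^sub>2 a * tvar + a 8 = 1"
      using at0(3) at1(3) att(3) inf(2) a1 by simp_all
    then show False by simp
  qed
  then have "1 / const n\<^sub>1 + 1 / const n\<^sub>2 + 1 / const n\<^sub>3 + 1 / const n\<^sub>4 = 2"
    using 0 1 2 inf(1) unfolding at0(4) at1(4) att(4) inf(3)
    by (intro sum_of_inverse_exponents[where t = tvar and ?a1.0 = "a 1" and ?a3.0 = "a 3" and ?a9.0 = "a 9"
          and ?a10.0 = "a 10"] t) simp_all
  then have "const (1 / n\<^sub>1 + 1 / n\<^sub>2 + 1 / n\<^sub>3 + 1 / n\<^sub>4) = const 2"
    by (simp only: const_add const_inverse const_2)
  then show ?thesis by simp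
qed

end
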